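(* Let $\mathcal{D}$ be a non-empty set of bounded conditional random variables, $\underline{P}:\mathcal{D}\to\mathbb{R}$ a map, $n\ge 0$ an integer, $X_0|B_0,\dots,X_n|B_n\in\mathcal{D}$ with $\bigwedge_{i=0}^nB_i\ne\emptyset$, and $s_0,\dots,s_n\ge 0$ real numbers. Define $B=\bigvee_{i=0}^nB_i$, $$I=-s_0B_0X_0+\sum_{i=1}^n s_iB_iX_i,\qquad E=-s_0B_0\underline{P}(X_0|B_0)+\sum_{i=1}^n s_iB_i\underline{P}(X_i|B_i).$$ If $$s_0\underline{P}(X_0|B_0)-\sum_{i=1}^n s_i\underline{P}(X_i|B_i)\ \ge\ \sup(-I|B),$$ then $\sup(I-E|B)\ge 0$.
   Context: Conventions. A bounded random variable is a bounded map $X:\mathcal{B}\to\mathbb{R}$ on a partition $\mathcal{B}$ of non-impossible events $\omega$ (the atoms); all random variables and events considered together are described on a common, sufficiently fine partition. An event $B$ is identified with the set of atoms implying it, and the same symbol $B$ denotes its indicator function; $\emptyset$ is the impossible event. For a non-impossible (non-empty) event $B$, the conditional random variable $X|B$ is the restriction of $X$ to the atoms implying $B$; $\sup(X|B)$ is the supremum of $X(\omega)$ over atoms $\omega\Rightarrow B$. The notation $I-E|B$ means $(I-E)|B$. *)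

theory Defs
  imports "HOL-Analysis.Analysis"
begin

text \<open>The common partition into non-impossible atoms is the type \<open>'a\<close>: events are sets of atoms and
  random variables are real functions on atoms.\<close>

definition bounded_rv :: "('a \<Rightarrow> real) \<Rightarrow> bool" where
  "bounded_rv X \<longleftrightarrow> bounded (range X)"

text \<open>\<open>X|B\<close> is a partial map, so that two conditional random variables are equal exactly when
  their conditioning events (their domains) are equal and their values agree there.\<close>

definition cond_rv :: "('a \<Rightarrow> real) \<Rightarrow> 'a set \<Rightarrow> ('a \<rightharpoonup> real)" where
  "cond_rv X B = (\<lambda>\<omega>. Some (X \<omega>)) |` B"

definition bounded_cond_rvs :: "('a \<rightharpoonup> real) set" where
  "bounded_cond_rvs = {cond_rv X B | X B. bounded_rv X \<and> B \<noteq> {}}"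

definition sup_cond :: "('a \<rightharpoonup> real) \<Rightarrow> real" where
  "sup_cond Y = (SUP \<omega>\<in>dom Y. the (Y \<omega>))"

end

theory Submission
  imports Defs
begin

text \<open>All the conditioning events occur together at some atom \<open>\<omega>\<close>. There every indicator equals \<open>1\<close>,
  so \<open>- E \<omega>\<close> is exactly the constant that the hypothesis bounds below by \<open>sup(- I|U)\<close>. That supremum is
  at least \<open>- I \<omega>\<close>, hence \<open>I \<omega> - E \<omega> \<ge> 0\<close>, and this single atom of \<open>U\<close> makes \<open>sup(I - E|U)\<close>
  non-negative.

  Both uses of a supremum as an upper bound rely on the random variable being bounded, since the
  supremum of a set of reals that is unbounded above is an unspecified number.
  Both \<open>I\<close> and \<open>E\<close> are instances of one combination of bounded random variables cut off by events, treated in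
  \<open>bounded_rv_signed_gain\<close>.\<close>

lemma bounded_rv_const: "bounded_rv (\<lambda>_. c)"
  by (simp add: bounded_rv_def image_constant_conv)

lemma bounded_rv_uminus: "bounded_rv X \<Longrightarrow> bounded_rv (\<lambda>\<omega>. - X \<omega>)"
  by (simp add: bounded_rv_def bounded_real)

lemma bounded_rv_add: "bounded_rv X \<Longrightarrow> bounded_rv Y \<Longrightarrow> bounded_rv (\<lambda>\<omega>. X \<omega> + Y \<omega>)"
  unfolding bounded_rv_def by (rule bounded_plus_comp)

lemma bounded_rv_diff: "bounded_rv X \<Longrightarrow> bounded_rv Y \<Longrightarrow> bounded_rv (\<lambda>\<omega>. X \<omega> - Y \<omega>)"
  unfolding bounded_rv_def by (rule bounded_minus_comp)

lemma bounded_rv_sum: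
  assumes "\<And>i. i \<in> K \<Longrightarrow> bounded_rv (Y i)"
  shows "bounded_rv (\<lambda>\<omega>. \<Sum>i\<in>K. Y i \<omega>)"
  using assms
  by (induction K rule: infinite_finite_induct) (auto intro: bounded_rv_add bounded_rv_const)

lemma bounded_rv_scaled_indicator:
  assumes "bounded_rv X"
  shows "bounded_rv (\<lambda>\<omega>. c * indicator A \<omega> * X \<omega>)"
proof -
  obtain M where M: "\<bar>X \<omega>\<bar> \<le> M" for \<omega>
    using assms by (auto simp: bounded_rv_def bounded_real)
  have "\<bar>c * indicator A \<omega> * X \<omega>\<bar> \<le> \<bar>c\<bar> * M" for \<omega>
  proof -
    have "0 \<le> M"
      using M[of \<omega>] by linarith
    then show ?thesis
      using M[of \<omega>] by (auto simp: indicator_def abs_mult intro: mult_left_mono)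
  qed
  then show ?thesis
    by (auto simp: bounded_rv_def bounded_real)
qed

text \<open>The common shape of \<open>I\<close> (with \<open>Y i = X i\<close>) and \<open>E\<close> (with \<open>Y i\<close> the constant
  \<open>P (cond_rv (X i) (B i))\<close>).\<close>

lemma bounded_rv_signed_gain:
  fixes n :: nat
  assumes "\<And>i. i \<le> n \<Longrightarrow> bounded_rv (Y i)"
  shows "bounded_rv (\<lambda>\<omega>. - (s 0 * indicator (B 0) \<omega> * Y 0 \<omega>)
           + (\<Sum>i=1..n. s i * indicator (B i) \<omega> * Y i \<omega>))"
  by (intro bounded_rv_add bounded_rv_uminus bounded_rv_sum bounded_rv_scaled_indicator assms) auto

lemma le_sup_cond:
  assumes "bounded_rv X" and "\<omega> \<in> B"
  shows "X \<omega> \<le> sup_cond (cond_rv X B)"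
proof -
  have dom: "dom (cond_rv X B) = B"
    by (auto simp: cond_rv_def restrict_map_def split: if_splits)
  have "bdd_above (X ` B)"
    using assms(1) unfolding bounded_rv_def
    by (intro bounded_imp_bdd_above) (auto elim: bounded_subset)
  with assms(2) have "X \<omega> \<le> (SUP \<omega>\<in>B. X \<omega>)"
    by (rule cSUP_upper)
  also have "\<dots> = sup_cond (cond_rv X B)"
    unfolding sup_cond_def dom by (auto simp: cond_rv_def)
  finally show ?thesis .
qed

theorem proposition3:
  fixes D :: "('a \<rightharpoonup> real) set"
    and P :: "('a \<rightharpoonup> real) \<Rightarrow> real"
    and n :: nat
    and X :: "nat \<Rightarrow> 'a \<Rightarrow> real"
    and B :: "nat \<Rightarrow> 'a set"
    and s :: "nat \<Rightarrow> real"
    and U :: "'a set"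
    and I E :: "'a \<Rightarrow> real"
  assumes "D \<noteq> {}"
    and "D \<subseteq> bounded_cond_rvs"
    and "\<And>i. i \<le> n \<Longrightarrow> bounded_rv (X i)"
    and "\<And>i. i \<le> n \<Longrightarrow> cond_rv (X i) (B i) \<in> D"
    and "(\<Inter>i\<in>{0..n}. B i) \<noteq> {}"
    and "\<And>i. i \<le> n \<Longrightarrow> s i \<ge> 0"
    and "U = (\<Union>i\<in>{0..n}. B i)"
    and "I = (\<lambda>\<omega>. - (s 0 * indicator (B 0) \<omega> * X 0 \<omega>)
                + (\<Sum>i=1..n. s i * indicator (B i) \<omega> * X i \<omega>))"
    and "E = (\<lambda>\<omega>. - (s 0 * indicator (B 0) \<omega> * P (cond_rv (X 0) (B 0)))
                + (\<Sum>i=1..n. s i * indicator (B i) \<omega> * P (cond_rv (X i) (B i))))"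
    and "s 0 * P (cond_rv (X 0) (B 0)) - (\<Sum>i=1..n. s i * P (cond_rv (X i) (B i)))
           \<ge> sup_cond (cond_rv (\<lambda>\<omega>. - I \<omega>) U)"
  shows "sup_cond (cond_rv (\<lambda>\<omega>. I \<omega> - E \<omega>) U) \<ge> 0"
proof -
  obtain \<omega> where "\<omega> \<in> (\<Inter>i\<in>{0..n}. B i)"
    using assms(5) by blast
  then have \<omega>: "\<omega> \<in> B i" if "i \<le> n" for i
    using that by simp
  then have \<omega>U: "\<omega> \<in> U"
    using assms(7) by auto
  have bI: "bounded_rv I"
    unfolding assms(8) by (rule bounded_rv_signed_gain) (rule assms(3))
  have bE: "bounded_rv E"
    unfolding assms(9)
    by (rule bounded_rv_signed_gain[where Y = "\<lambda>i _. P (cond_rv (X i) (B i))"])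
      (rule bounded_rv_const)
  have "- I \<omega> \<le> sup_cond (cond_rv (\<lambda>\<omega>. - I \<omega>) U)"
    using bounded_rv_uminus[OF bI] \<omega>U by (rule le_sup_cond)
  also have "\<dots> \<le> s 0 * P (cond_rv (X 0) (B 0)) - (\<Sum>i=1..n. s i * P (cond_rv (X i) (B i)))"
    by (rule assms(10))
  also have "\<dots> = - E \<omega>"
    using \<omega> by (simp add: assms(9))
  finally have "0 \<le> I \<omega> - E \<omega>"
    by simp
  also have "\<dots> \<le> sup_cond (cond_rv (\<lambda>\<omega>. I \<omega> - E \<omega>) U)"
    using bounded_rv_diff[OF bI bE] \<omega>U by (rule le_sup_cond)
  finally show ?thesis .
qed

end
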